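(* Let $a,b$ be real numbers with $0<b<a$ and $\frac{b^{2}}{16(a^{2}-b^{2})}<\frac{1}{16}$. Then $$\int_{0}^{b} \frac{\ln x \, dx}{\sqrt{(a^{2}-x^{2})(b^{2}-x^{2})}} = \frac{1}{a}\ln\left(\frac{b}{2}\right)\mathbf{K}\left(\frac{b}{a}\right) - \frac{\pi}{4\sqrt{a^{2}-b^{2}}}\,F\left(\frac{b^{2}}{16(a^{2}-b^{2})}\right).$$
   Context: $\mathbf{K}(k)=\int_{0}^{1}\frac{dx}{\sqrt{(1-x^{2})(1-k^{2}x^{2})}}$ for $0\le k<1$ is the complete elliptic integral of the first kind as a function of the modulus $k$. The function $F$ is defined by the power series $$F(x)=\sum_{n=0}^{\infty}(-1)^{n}\binom{2n}{n}^{2}H_{n}\,x^{n},\qquad |x|<\tfrac{1}{16},$$ where $H_{n}=1+\tfrac12+\tfrac13+\cdots+\tfrac1n$ is the harmonic number, with $H_0=0$. *)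

theory Defs
  imports "HOL-Analysis.Analysis"
begin

text \<open>
  Complete elliptic integral of the first kind as a function of the modulus \<open>k\<close> (not of the
  parameter \<open>k\<^sup>2\<close>), meaningful for \<open>0 \<le> k < 1\<close>. The integrand is unbounded at \<open>1\<close>; the
  Henstock-Kurzweil integral takes the value of the improper Riemann integral.
\<close>
definition ellK :: "real \<Rightarrow> real" where
  "ellK k = integral {0..1} (\<lambda>x. 1 / sqrt ((1 - x\<^sup>2) * (1 - k\<^sup>2 * x\<^sup>2)))"

text \<open>Meaningful for \<open>\<bar>x\<bar> < 1/16\<close>, the disc of convergence.\<close>
definition harmF :: "real \<Rightarrow> real" where
  "harmF x = (\<Sum>n. (-1) ^ n * (real ((2 * n) choose n))\<^sup>2 * harm n * x ^ n)"

end

theory Submission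
  imports Defs "HOL-Real_Asymp.Real_Asymp"
begin

text \<open>
  With \<open>x = b sin t\<close> and \<open>m = b\<^sup>2 / (a\<^sup>2 - b\<^sup>2) < 1\<close> the integrand becomes
  \<open>ln (b sin t) / sqrt (1 + m cos\<^sup>2 t)\<close> up to the factor \<open>1 / sqrt (a\<^sup>2 - b\<^sup>2)\<close>. The binomial series
  in \<open>m cos\<^sup>2 t\<close> may be integrated term by term, and
  \<open>\<integral> cos\<^sup>2\<^sup>n t ln (sin t) dt = - W\<^sub>n (ln 2 + H\<^sub>n / 2)\<close>, where
  \<open>W\<^sub>n = \<integral> cos\<^sup>2\<^sup>n t dt\<close>, all integrals being over \<open>[0, \<pi>/2]\<close>. The part without \<open>H\<^sub>n\<close> sums up to
  \<open>ln (b / 2)\<close> times the elliptic integral.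
\<close>

section \<open>Central binomial coefficients\<close>

text \<open>Closed form of the Wallis integral of \<open>cos t ^ (2 * n)\<close> over [0, pi/2];
  \<open>has_integral_cos_power\<close> proves the agreement.\<close>

definition wallis :: "nat \<Rightarrow> real" where
  "wallis n = pi / 2 * real ((2 * n) choose n) / 4 ^ n"

lemma central_binomial_Suc:
  "real (Suc n) * real ((2 * Suc n) choose Suc n) = 2 * (2 * real n + 1) * real ((2 * n) choose n)"
proof -
  \<comment> \<open>Used with \<open>x\<close> = n + 1 and \<open>G\<close> = n!; abstract variables
    keep the factorials opaque.\<close>
  have cancel: "2 * x * y * F / (x * G * (x * G)) = 2 * y / x * (F / (G * G))"
    if "x \<noteq> 0" "G \<noteq> 0" for x y F G :: real
    using that by (simp add: mult_ac)
  have "real ((2 * Suc n) choose Suc n) = fact (Suc (Suc (2 * n))) / (fact (Suc n) * fact (Suc n))"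
    by (subst binomial_fact) auto
  also have "\<dots> = (2 * (real n + 1) * (2 * real n + 1) * fact (2 * n)) / ((real n + 1) * fact n * ((real n + 1) * fact n))"
    by (simp add: algebra_simps)
  also have "\<dots> = 2 * (2 * real n + 1) / (real n + 1) * (fact (2 * n) / (fact n * fact n))"
    by (rule cancel) auto
  also have "fact (2 * n) / (fact n * fact n) = real ((2 * n) choose n)"
    by (subst binomial_fact) auto
  finally show ?thesis
    by (simp add: field_simps del: mult_Suc_right binomial_Suc_Suc)
qed

text \<open>Both sides are 1 at n = 0 and obey the same recurrence. The alternating sign in
  \<open>harmF\<close> and one of its two binomial factors come from here.\<close>

lemma gbinomial_minus_half:
  "((-1/2 :: real) gchoose n) = (-1) ^ n * real ((2 * n) choose n) / 4 ^ n"
proof (induction n)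
  case (Suc n)
  have "real (Suc n) * ((-1/2 :: real) gchoose Suc n) = (-1/2 - real n) * ((-1/2) gchoose n)"
    using gbinomial_mult_1[of "-1/2 :: real" n] by (simp add: algebra_simps)
  also have "\<dots> = (-1) ^ Suc n * (real (Suc n) * real ((2 * Suc n) choose Suc n)) / 4 ^ Suc n"
    by (simp only: Suc.IH central_binomial_Suc) (simp add: field_simps)
  finally have "real (Suc n) * ((-1/2 :: real) gchoose Suc n) =
    real (Suc n) * ((-1) ^ Suc n * real ((2 * Suc n) choose Suc n) / 4 ^ Suc n)"
    by simp
  then show ?case by (simp only: mult_cancel_left) simp
qed simp

text \<open>The recurrence that integration by parts yields for even cosine powers.\<close>

lemma wallis_Suc: "(2 * real n + 2) * wallis (Suc n) = (2 * real n + 1) * wallis n"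
proof -
  have "(2 * real n + 2) * wallis (Suc n) =
      pi * (real (Suc n) * real ((2 * Suc n) choose Suc n)) / 4 ^ Suc n"
    by (simp add: wallis_def field_simps del: mult_Suc_right binomial_Suc_Suc)
  also have "\<dots> = (2 * real n + 1) * wallis n"
    unfolding central_binomial_Suc by (simp add: wallis_def field_simps)
  finally show ?thesis .
qed

section \<open>Integrals of cosine powers and of \<open>ln (sin t)\<close>\<close>

text \<open>At 0 the product is 0, which is also its limit. Continuity up to 0 lets antiderivatives
  containing \<open>sin t * ln (sin t)\<close> be evaluated at the singular endpoint.\<close>

lemma continuous_on_mult_ln: "continuous_on {0..} (\<lambda>x::real. x * ln x)"
  unfolding continuous_on_def
proof
  fix x :: real assume "x \<in> {0..}"
  then consider "x = 0" | "x > 0" by fastforce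
  then show "((\<lambda>x. x * ln x) \<longlongrightarrow> x * ln x) (at x within {0..})"
  proof cases
    case 1
    have "at (0::real) within {0..} = at_right 0"
      by (auto simp: at_within_def intro!: arg_cong2[of _ _ _ _ inf] arg_cong[of _ _ principal])
    moreover have "((\<lambda>x::real. x * ln x) \<longlongrightarrow> 0) (at_right 0)"
      by real_asymp
    ultimately show ?thesis using 1 by simp
  qed (auto intro!: tendsto_intros)
qed

lemma has_integral_reflect_about:
  fixes f :: "real \<Rightarrow> real"
  assumes "(f has_integral I) {a..b}"
  shows "((\<lambda>x. f (c - x)) has_integral I) {c - b..c - a}"
proof -
  have "(\<lambda>x::real. c - x) ` {a..b} = {c - b..c - a}"
    by (simp add: image_diff_atLeastAtMost)
  with has_integral_affinity[of f I a b "-1" c] assms show ?thesis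
    by simp
qed

lemma continuous_on_sin_ln_sin: "continuous_on {0..pi/2} (\<lambda>t. sin t * ln (sin t))"
  by (rule continuous_on_compose2[OF continuous_on_mult_ln])
     (auto intro!: continuous_intros sin_ge_zero)

text \<open>
  \<open>ln (sin t) = cos t ln (sin t) + sin\<^sup>2 t ln (sin t) / (1 + cos t)\<close>, where the first summand is a
  derivative up to \<open>cos t\<close> and the second one is continuous.
\<close>
lemma ln_sin_integrable: "(\<lambda>t. ln (sin t)) integrable_on {0..pi/2}"
proof -
  have "((\<lambda>t. cos t * ln (sin t) + cos t) has_integral
          (sin (pi/2) * ln (sin (pi/2)) - sin 0 * ln (sin 0))) {0..pi/2}"
  proof (rule fundamental_theorem_of_calculus_interior[OF _ continuous_on_sin_ln_sin])
    fix t :: real assume "t \<in> {0<..<pi/2}"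
    then have "sin t > 0" by (intro sin_gt_zero) auto
    then show "((\<lambda>t. sin t * ln (sin t)) has_vector_derivative cos t * ln (sin t) + cos t) (at t)"
      unfolding has_real_derivative_iff_has_vector_derivative[symmetric]
      by (auto intro!: derivative_eq_intros)
  qed simp
  then have 1: "(\<lambda>t. cos t * ln (sin t) + cos t) integrable_on {0..pi/2}" by blast
  have cos0: "1 + cos t \<noteq> 0" if "t \<in> {0..pi/2}" for t
    using that cos_ge_zero[of t] by auto
  have 2: "(\<lambda>t. sin t * (sin t * ln (sin t)) / (1 + cos t) - cos t) integrable_on {0..pi/2}"
    using cos0 by (intro integrable_continuous_real continuous_intros continuous_on_sin_ln_sin) auto
  \<comment> \<open>The logarithm enters linearly, so the identity also holds at t = 0, whatever the
    value of ln 0.\<close>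
  have eq: "(cos t * ln (sin t) + cos t) + (sin t * (sin t * ln (sin t)) / (1 + cos t) - cos t) = ln (sin t)"
    if "t \<in> {0..pi/2}" for t
  proof -
    have *: "sin t * (sin t * ln (sin t)) = (1 + cos t) * ((1 - cos t) * ln (sin t))"
      unfolding mult.assoc[symmetric] power2_eq_square[of "sin t", symmetric] sin_squared_eq
      by (simp add: power2_eq_square algebra_simps)
    show ?thesis unfolding * nonzero_mult_div_cancel_left[OF cos0[OF that]] by (simp add: algebra_simps)
  qed
  show ?thesis
    by (rule integrable_eq[OF integrable_add[OF 1 2]]) (use eq in simp)
qed

text \<open>Integrating \<open>ln (sin (2 t)) = ln 2 + ln (sin t) + ln (cos t)\<close> gives \<open>I = \<pi> / 2 * ln 2 + 2 I\<close>.\<close>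
lemma has_integral_ln_sin: "((\<lambda>t. ln (sin t)) has_integral (- (pi / 2 * ln 2))) {0..pi/2}"
proof -
  obtain I where I: "((\<lambda>t. ln (sin t)) has_integral I) {0..pi/2}"
    using ln_sin_integrable by blast
  \<comment> \<open>Symmetry about pi/2 gives 2 I over [0, pi], and rescaling t to 2 t halves this
    to I again.\<close>
  have "((\<lambda>t. ln (sin (pi - t))) has_integral I) {pi - pi/2..pi - 0}"
    by (rule has_integral_reflect_about[OF I])
  then have "((\<lambda>t. ln (sin t)) has_integral I) {pi/2..pi}"
    by simp
  from has_integral_combine[OF _ _ I this]
  have "((\<lambda>t. ln (sin t)) has_integral I + I) {0..pi}" by simp
  from has_integral_stretch_real[OF this, of 2]
  have double: "((\<lambda>t. ln (sin (2 * t))) has_integral I) {0..pi/2}" by simp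
  have "((\<lambda>t. ln (sin (pi/2 - t))) has_integral I) {pi/2 - pi/2..pi/2 - 0}"
    by (rule has_integral_reflect_about[OF I])
  then have cosI: "((\<lambda>t. ln (cos t)) has_integral I) {0..pi/2}"
    by (simp add: sin_diff)
  have "((\<lambda>t::real. ln 2) has_integral (pi/2 * ln 2)) {0..pi/2}"
    using has_integral_const_real[of "ln 2::real" 0 "pi/2"] by simp
  from has_integral_add[OF this has_integral_add[OF I cosI]]
  have "((\<lambda>t. ln (sin (2 * t))) has_integral (pi/2 * ln 2 + (I + I))) {0..pi/2}"
  \<comment> \<open>At both endpoints the logarithm law fails: the left side is ln 0 = 0, the right
    side ln 2.\<close>
  proof (rule has_integral_spike_finite[of "{0, pi/2}", rotated 2])
    fix t assume "t \<in> {0..pi/2} - {0, pi/2}"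
    then have "sin t > 0" "cos t > 0" by (auto intro!: sin_gt_zero cos_gt_zero)
    then show "ln (sin (2 * t)) = ln 2 + (ln (sin t) + ln (cos t))"
      by (simp add: sin_double ln_mult)
  qed simp
  with double have "I = pi/2 * ln 2 + (I + I)" by (rule has_integral_unique)
  then have "I = - (pi / 2 * ln 2)" by simp
  with I show ?thesis by simp
qed

text \<open>The function \<open>sin t * cos t ^ (2 * n + 1)\<close> vanishes at both ends;
  integrating its derivative gives the recurrence \<open>wallis_Suc\<close>.\<close>

lemma has_integral_cos_power: "((\<lambda>t. cos t ^ (2 * n)) has_integral wallis n) {0..pi/2}"
proof (induction n)
  case 0
  then show ?case
    using has_integral_const_real[of "1::real" 0 "pi/2"] by (simp add: wallis_def)
next
  case (Suc n)
  have "((\<lambda>t. (2 * real n + 2) * cos t ^ (2 * Suc n) - (2 * real n + 1) * cos t ^ (2 * n)) has_integral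
          (sin (pi/2) * cos (pi/2) ^ (2 * n + 1) - sin 0 * cos 0 ^ (2 * n + 1))) {0..pi/2}"
  proof (rule fundamental_theorem_of_calculus)
    fix t :: real
    have "cos t * cos t ^ (2 * n + 1) - (2 * real n + 1) * (sin t)\<^sup>2 * cos t ^ (2 * n) =
        (2 * real n + 2) * cos t ^ (2 * Suc n) - (2 * real n + 1) * cos t ^ (2 * n)"
      unfolding sin_squared_eq by (simp add: power2_eq_square algebra_simps)
    moreover have "((\<lambda>t. sin t * cos t ^ (2 * n + 1)) has_real_derivative
       cos t * cos t ^ (2 * n + 1) - (2 * real n + 1) * (sin t)\<^sup>2 * cos t ^ (2 * n)) (at t within {0..pi/2})"
      by ((rule derivative_eq_intros refl)+, simp add: power2_eq_square algebra_simps)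
    ultimately show "((\<lambda>t. sin t * cos t ^ (2 * n + 1)) has_vector_derivative
       (2 * real n + 2) * cos t ^ (2 * Suc n) - (2 * real n + 1) * cos t ^ (2 * n)) (at t within {0..pi/2})"
      by (simp add: has_real_derivative_iff_has_vector_derivative)
  qed simp
  from has_integral_mult_right[OF has_integral_add[OF this has_integral_mult_right[OF Suc.IH, of "2 * real n + 1"]],
      of "1 / (2 * real n + 2)"]
  have "((\<lambda>t. cos t ^ (2 * Suc n)) has_integral ((2 * real n + 1) * wallis n / (2 * real n + 2))) {0..pi/2}"
    by simp
  also have "(2 * real n + 1) * wallis n / (2 * real n + 2) = wallis (Suc n)"
    using wallis_Suc[of n] by (simp add: field_simps)
  finally show ?case .
qed

text \<open>The same integration by parts with an extra factor \<open>ln (sin t)\<close>.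
  Differentiating the logarithm adds \<open>cos t ^ (2 * n + 2)\<close>, whose integral divided by 2
  n + 2 supplies the next term of the harmonic sum.\<close>

lemma has_integral_cos_power_ln_sin:
  "((\<lambda>t. ln (sin t) * cos t ^ (2 * n)) has_integral (- wallis n * (ln 2 + harm n / 2))) {0..pi/2}"
proof (induction n)
  case 0
  then show ?case using has_integral_ln_sin by (simp add: wallis_def harm_expand)
next
  case (Suc n)
  let ?g = "\<lambda>t. (2 * real n + 2) * (ln (sin t) * cos t ^ (2 * Suc n))
                  - (2 * real n + 1) * (ln (sin t) * cos t ^ (2 * n)) + cos t ^ (2 * Suc n)"
  \<comment> \<open>The factor \<open>sin t\<close> makes this continuous at 0, and both boundary
    values are 0.\<close>
  let ?G = "\<lambda>t. (sin t * ln (sin t)) * cos t ^ (2 * n + 1)"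
  have "(?g has_integral (?G (pi/2) - ?G 0)) {0..pi/2}"
  proof (rule fundamental_theorem_of_calculus_interior)
    show "continuous_on {0..pi/2} ?G"
      by (intro continuous_on_mult continuous_on_sin_ln_sin continuous_intros)
    fix t :: real assume "t \<in> {0<..<pi/2}"
    then have "sin t > 0" by (intro sin_gt_zero) auto
    have "(cos t * ln (sin t) + cos t) * cos t ^ (2 * n + 1)
        - (2 * real n + 1) * (sin t)\<^sup>2 * ln (sin t) * cos t ^ (2 * n) = ?g t"
      unfolding sin_squared_eq by (simp add: power2_eq_square algebra_simps)
    moreover have "(?G has_real_derivative (cos t * ln (sin t) + cos t) * cos t ^ (2 * n + 1)
        - (2 * real n + 1) * (sin t)\<^sup>2 * ln (sin t) * cos t ^ (2 * n)) (at t)"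
      using \<open>sin t > 0\<close>
      by - ((rule derivative_eq_intros refl \<open>sin t > 0\<close>)+, simp add: power2_eq_square algebra_simps)
    ultimately show "(?G has_vector_derivative ?g t) (at t)"
      by (simp add: has_real_derivative_iff_has_vector_derivative)
  qed simp
  then have "(?g has_integral 0) {0..pi/2}" by simp
  from has_integral_diff[OF has_integral_add[OF this
        has_integral_mult_right[OF Suc.IH, of "2 * real n + 1"]] has_integral_cos_power[of "Suc n"]]
  have "((\<lambda>t. (2 * real n + 2) * (ln (sin t) * cos t ^ (2 * Suc n))) has_integral
    (- ((2 * real n + 1) * (wallis n * (ln 2 + harm n / 2))) - wallis (Suc n))) {0..pi/2}"
    by simp
  from has_integral_mult_right[OF this, of "1 / (2 * real n + 2)"]
  have "((\<lambda>t. ln (sin t) * cos t ^ (2 * Suc n)) has_integral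
    ((- ((2 * real n + 1) * (wallis n * (ln 2 + harm n / 2))) - wallis (Suc n)) / (2 * real n + 2))) {0..pi/2}"
    by simp
  also have "(- ((2 * real n + 1) * (wallis n * (ln 2 + harm n / 2))) - wallis (Suc n)) / (2 * real n + 2)
      = - wallis (Suc n) * (ln 2 + harm (Suc n) / 2)"
    unfolding mult.assoc[symmetric] wallis_Suc[symmetric] harm_Suc by (simp add: field_simps)
  finally show ?case .
qed

section \<open>Termwise integration and substitution\<close>

text \<open>Dominated convergence: since |cos t| is at most 1, the partial sums are bounded by a
  constant times |\<phi>|. The weight \<phi> will be 1 for the elliptic integral and
  \<open>ln (sin t)\<close> for the logarithmic one.\<close>

lemma binomial_series_integral:
  fixes \<phi> :: "real \<Rightarrow> real"
  assumes m: "0 \<le> m" "m < 1"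
    and \<phi>: "\<phi> absolutely_integrable_on {0..pi/2}"
    and J: "\<And>n. ((\<lambda>t. \<phi> t * cos t ^ (2 * n)) has_integral J n) {0..pi/2}"
  shows "(\<lambda>t. \<phi> t / sqrt (1 + m * (cos t)\<^sup>2)) absolutely_integrable_on {0..pi/2}" (is "?g absolutely_integrable_on _")
    and "(\<lambda>n. ((-1/2) gchoose n) * m ^ n * J n) sums integral {0..pi/2} (\<lambda>t. \<phi> t / sqrt (1 + m * (cos t)\<^sup>2))"
proof -
  define c :: "nat \<Rightarrow> real" where "c n = (-1/2) gchoose n" for n
  define B where "B = (1 + (- m)) powr (-1/2)"
  define f where "f N t = (\<Sum>n<N. c n * m ^ n * (\<phi> t * cos t ^ (2 * n)))" for N t
  \<comment> \<open>The coefficients alternate in sign, so the series at - m is the series of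
    absolute values and sums to \<open>B\<close>.\<close>
  have c_abs: "c n * (- m) ^ n = \<bar>c n * m ^ n\<bar>" for n
  proof -
    have "(- m) ^ n = (-1) ^ n * m ^ n" by (rule power_minus)
    then have "c n * (- m) ^ n = \<bar>c n\<bar> * m ^ n"
      unfolding c_def gbinomial_minus_half by (simp add: abs_mult power_abs)
    then show ?thesis using m by (simp add: abs_mult)
  qed
  have B: "(\<lambda>n. \<bar>c n * m ^ n\<bar>) sums B"
    using gen_binomial_real[of "- m" "-1/2"] m
    unfolding B_def c_abs[symmetric] by (simp add: c_def)
  have f_int: "(f N has_integral (\<Sum>n<N. c n * m ^ n * J n)) {0..pi/2}" for N
    unfolding f_def by (intro has_integral_sum has_integral_mult_right J) auto
  have f_le: "norm (f N t) \<le> B * \<bar>\<phi> t\<bar>" for N t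
  proof -
    have "norm (f N t) \<le> (\<Sum>n<N. \<bar>c n * m ^ n\<bar> * \<bar>\<phi> t\<bar>)"
      unfolding f_def
    proof (rule sum_norm_le)
      fix n
      have "\<bar>cos t ^ (2 * n)\<bar> \<le> 1"
        by (simp add: power_abs power_le_one)
      then have "\<bar>\<phi> t\<bar> * \<bar>cos t ^ (2 * n)\<bar> \<le> \<bar>\<phi> t\<bar> * 1"
        by (intro mult_left_mono) auto
      then show "norm (c n * m ^ n * (\<phi> t * cos t ^ (2 * n))) \<le> \<bar>c n * m ^ n\<bar> * \<bar>\<phi> t\<bar>"
        unfolding real_norm_def abs_mult[of "c n * m ^ n"] abs_mult[of "\<phi> t"]
        by (intro mult_left_mono) auto
    qed
    also have "\<dots> = (\<Sum>n<N. \<bar>c n * m ^ n\<bar>) * \<bar>\<phi> t\<bar>"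
      by (simp add: sum_distrib_right)
    also have "\<dots> \<le> B * \<bar>\<phi> t\<bar>"
      using sum_le_suminf[OF sums_summable[OF B], of "{..<N}"] sums_unique[OF B]
      by (intro mult_right_mono) auto
    finally show ?thesis .
  qed
  have lim: "(\<lambda>N. f N t) \<longlonglongrightarrow> ?g t" for t
  proof -
    let ?z = "m * (cos t)\<^sup>2"
    have z: "0 \<le> ?z" "?z < 1"
      using m mult_left_mono[of "(cos t)\<^sup>2" 1 m] by (auto simp: abs_square_le_1)
    then have "(\<lambda>n. c n * ?z ^ n) sums (1 + ?z) powr (-1/2)"
      unfolding c_def by (intro gen_binomial_real) auto
    moreover have "(1 + ?z) powr (-1/2) = 1 / sqrt (1 + ?z)"
      using z powr_minus_divide[of "1 + ?z" "1/2"] by (simp add: powr_half_sqrt)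
    ultimately have "(\<lambda>n. \<phi> t * (c n * ?z ^ n)) sums (\<phi> t * (1 / sqrt (1 + ?z)))"
      by (intro sums_mult) simp
    moreover have "\<phi> t * (c n * ?z ^ n) = c n * m ^ n * (\<phi> t * cos t ^ (2 * n))" for n
      unfolding power_mult_distrib power_mult[of "cos t" 2 n] by (simp only: mult_ac)
    ultimately show ?thesis
      unfolding sums_def f_def by simp
  qed
  have bound: "(\<lambda>t. B * \<bar>\<phi> t\<bar>) integrable_on {0..pi/2}"
    using \<phi> by (intro integrable_on_mult_right) (simp add: absolutely_integrable_on_def)
  note conv = dominated_convergence[of f "{0..pi/2}" "\<lambda>t. B * \<bar>\<phi> t\<bar>" ?g,
      OF has_integral_integrable[OF f_int] bound f_le lim]
  show "?g absolutely_integrable_on {0..pi/2}"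
  \<comment> \<open>The square root is at least 1, so |\<phi>| dominates the limit function.\<close>
  proof (rule absolutely_integrable_integrable_bound)
    show "norm (?g t) \<le> \<bar>\<phi> t\<bar>" for t
      using m by (simp add: abs_mult divide_le_eq mult_left_le mult_le_cancel_left1)
    show "(\<lambda>t. \<bar>\<phi> t\<bar>) integrable_on {0..pi/2}"
      using \<phi> by (simp add: absolutely_integrable_on_def)
  qed (rule conv(1))
  show "(\<lambda>n. ((-1/2) gchoose n) * m ^ n * J n) sums integral {0..pi/2} ?g"
    using conv(2) integral_unique[OF f_int] unfolding sums_def c_def by simp
qed

text \<open>For x = b sin t the Jacobian b cos t cancels the square root. The open interval makes
  the map injective with cos t > 0, and absolute integrability is what the change of variables
  transfers.\<close>

lemma has_integral_sin_substitution:
  fixes f :: "real \<Rightarrow> real"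
  assumes b: "0 < b"
    and f: "(\<lambda>t. f (b * sin t)) absolutely_integrable_on {0..pi/2}"
  shows "((\<lambda>x. f x / sqrt (b\<^sup>2 - x\<^sup>2)) has_integral
           integral {0..pi/2} (\<lambda>t. f (b * sin t))) {0..b}"
proof -
  let ?S = "{0<..<pi/2}" and ?h = "\<lambda>x. f x / sqrt (b\<^sup>2 - x\<^sup>2)"
  have inj: "inj_on (\<lambda>t. b * sin t) ?S"
    using b by (auto intro!: inj_onI simp: sin_inj_pi)
  have img: "(\<lambda>t. b * sin t) ` ?S = {0<..<b}"
  proof safe
    fix t assume "t \<in> ?S"
    then have "0 < sin t" "sin t < sin (pi/2)"
      by (auto intro!: sin_gt_zero sin_monotone_2pi simp del: sin_pi_half)
    with b show "b * sin t \<in> {0<..<b}" by auto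
  next
    fix x assume x: "x \<in> {0<..<b}"
    then have y: "0 < x / b" "x / b < 1" using b by auto
    have "arcsin 0 < arcsin (x / b)" "arcsin (x / b) < arcsin 1"
      using y by (auto intro!: arcsin_less_mono[THEN iffD2] simp del: arcsin_0 arcsin_1)
    then have "arcsin (x / b) \<in> ?S" by simp
    moreover have "x = b * sin (arcsin (x / b))" using y b by simp
    ultimately show "x \<in> (\<lambda>t. b * sin t) ` ?S" by blast
  qed
  have eq: "\<bar>b * cos t\<bar> * ?h (b * sin t) = f (b * sin t)" if "t \<in> ?S" for t
  proof -
    have "cos t > 0" using that by (auto intro!: cos_gt_zero)
    have "b\<^sup>2 - (b * sin t)\<^sup>2 = (b * cos t)\<^sup>2"
      by (simp add: cos_squared_eq power_mult_distrib algebra_simps)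
    then have "sqrt (b\<^sup>2 - (b * sin t)\<^sup>2) = b * cos t" using b \<open>cos t > 0\<close> by simp
    with b \<open>cos t > 0\<close> show ?thesis by simp
  qed
  have "(\<lambda>t. f (b * sin t)) absolutely_integrable_on ?S"
    using f by (simp add: absolutely_integrable_on_Icc_iff_Ioo)
  then have "(\<lambda>t. \<bar>b * cos t\<bar> * ?h (b * sin t)) absolutely_integrable_on ?S"
    by (rule absolutely_integrable_spike[where S = "{}"]) (use eq in auto)
  moreover have "integral ?S (\<lambda>t. \<bar>b * cos t\<bar> * ?h (b * sin t)) = integral {0..pi/2} (\<lambda>t. f (b * sin t))"
    using integral_cong[of ?S, OF eq] by (simp add: integral_open_interval_real)
  ultimately have "?h absolutely_integrable_on {0<..<b} \<and>
      integral {0<..<b} ?h = integral {0..pi/2} (\<lambda>t. f (b * sin t))"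
    unfolding img[symmetric]
    by (subst has_absolute_integral_change_of_variables_1'[symmetric])
       (auto intro!: inj derivative_eq_intros)
  then show ?thesis
    by (metis absolutely_integrable_on_def has_integral_Icc_iff_Ioo integrable_integral)
qed

section \<open>Evaluation of the logarithmic integral\<close>

theorem theorem3p2:
  fixes a b :: real
  assumes "0 < b" and "b < a"
    and "b\<^sup>2 / (16 * (a\<^sup>2 - b\<^sup>2)) < 1 / 16"
  shows "((\<lambda>x. ln x / sqrt ((a\<^sup>2 - x\<^sup>2) * (b\<^sup>2 - x\<^sup>2))) has_integral
           (1 / a * ln (b / 2) * ellK (b / a)
            - pi / (4 * sqrt (a\<^sup>2 - b\<^sup>2)) * harmF (b\<^sup>2 / (16 * (a\<^sup>2 - b\<^sup>2)))))
         {0..b}"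
proof -
  define d where "d = a\<^sup>2 - b\<^sup>2"
  \<comment> \<open>Chosen so that a^2 - b^2 sin^2 t = d (1 + m cos^2 t). The third hypothesis says
    m < 1, and \<open>harmF\<close> is evaluated at m / 16.\<close>
  define m where "m = b\<^sup>2 / d"
  define P where "P = integral {0..pi/2} (\<lambda>t. 1 / sqrt (1 + m * (cos t)\<^sup>2))"
  define Q where "Q = integral {0..pi/2} (\<lambda>t. ln (sin t) / sqrt (1 + m * (cos t)\<^sup>2))"
  define e where "e n = ((-1/2) gchoose n) * m ^ n * wallis n" for n
  have d: "d > 0" using assms by (simp add: d_def power_strict_mono)
  have m: "0 \<le> m" "m < 1"
    using assms(3) d unfolding m_def d_def[symmetric] by (simp_all add: field_simps)
  have one: "(\<lambda>t::real. 1::real) absolutely_integrable_on {0..pi/2}"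
    by (intro absolutely_integrable_continuous_real continuous_intros)
  have lnsin: "(\<lambda>t. ln (sin t)) absolutely_integrable_on {0..pi/2}"
  proof -
    \<comment> \<open>A function of constant sign is absolutely integrable once it is integrable; at
      t = 0 the bound uses ln 0 = 0.\<close>
    have "0 \<le> - ln (sin t)" if "t \<in> {0..pi/2}" for t
      using that sin_ge_zero[of t] by (cases "sin t = 0") auto
    from set_integrable_mult_right[OF nonnegative_absolutely_integrable_1[OF integrable_neg[OF ln_sin_integrable] this], of "-1"]
    show ?thesis by simp
  qed
  note P = binomial_series_integral[OF m one, folded P_def, simplified mult_1, OF has_integral_cos_power,
     folded P_def e_def]
  note Q = binomial_series_integral[OF m lnsin has_integral_cos_power_ln_sin, folded Q_def]

  \<comment> \<open>Adding ln 2 times the series of \<open>P\<close> removes the ln 2 part from that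
    of \<open>Q\<close> and leaves - e n H_n / 2.\<close>
  have "(\<lambda>n. - 2 * (ln 2 * e n + ((-1/2) gchoose n) * m ^ n * (- wallis n * (ln 2 + harm n / 2)))) sums
      (- 2 * (ln 2 * P + Q))"
    by (intro sums_mult sums_add P Q)
  then have "(\<lambda>n. e n * harm n) sums (- 2 * (ln 2 * P + Q))"
    by (simp add: e_def algebra_simps)
  \<comment> \<open>The second binomial factor comes from \<open>wallis n\<close>; the two powers of
    4 turn m into m / 16.\<close>
  moreover have "e n * harm n = pi / 2 *
     ((-1) ^ n * (real ((2 * n) choose n))\<^sup>2 * harm n * (m / 16) ^ n)" for n
  proof -
    have "(16::real) ^ n = 4 ^ n * 4 ^ n" by (simp add: power_mult_distrib[symmetric])
    then show ?thesis
      unfolding e_def wallis_def gbinomial_minus_half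
      by (simp add: power_divide power2_eq_square mult_ac)
  qed
  ultimately have "(\<lambda>n. pi / 2 * ((-1) ^ n * (real ((2 * n) choose n))\<^sup>2 * harm n * (m / 16) ^ n)) sums
     (- 2 * (ln 2 * P + Q))"
    by simp
  from sums_mult[OF this, of "2 / pi"]
  have "(\<lambda>n. (-1) ^ n * (real ((2 * n) choose n))\<^sup>2 * harm n * (m / 16) ^ n) sums
     (2 / pi * (- 2 * (ln 2 * P + Q)))"
    by (simp add: mult.assoc)
  then have "harmF (m / 16) = 2 / pi * (- 2 * (ln 2 * P + Q))"
    unfolding harmF_def by (rule sums_unique[symmetric])
  then have Q_eq: "Q = - ln 2 * P - pi / 4 * harmF (m / 16)"
    by (simp add: field_simps)

  have root: "sqrt (a\<^sup>2 - (b * sin t)\<^sup>2) = sqrt d * sqrt (1 + m * (cos t)\<^sup>2)" for t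
  proof -
    have "d * (1 + m * (cos t)\<^sup>2) = d + b\<^sup>2 * (cos t)\<^sup>2"
      using d by (simp add: m_def field_simps)
    then have "a\<^sup>2 - (b * sin t)\<^sup>2 = d * (1 + m * (cos t)\<^sup>2)"
      by (simp add: cos_squared_eq d_def power_mult_distrib algebra_simps)
    then show ?thesis by (simp add: real_sqrt_mult)
  qed
  have "a > 0" using assms by simp
  have root1: "1 / sqrt (1 - (b / a)\<^sup>2 * (sin t)\<^sup>2) = a / sqrt d * (1 / sqrt (1 + m * (cos t)\<^sup>2))" for t
  proof -
    have "1 - (b / a)\<^sup>2 * (sin t)\<^sup>2 = (a\<^sup>2 - (b * sin t)\<^sup>2) / a\<^sup>2"
      using \<open>a > 0\<close> by (simp add: field_simps power_mult_distrib)
    then have "sqrt (1 - (b / a)\<^sup>2 * (sin t)\<^sup>2) = sqrt d * sqrt (1 + m * (cos t)\<^sup>2) / a"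
      using \<open>a > 0\<close> by (simp add: real_sqrt_divide root)
    then show ?thesis by simp
  qed
  have "ellK (b / a) = a / sqrt d * P"
  proof -
    \<comment> \<open>The sine substitution with radius 1; \<open>root1\<close> then converts the
      modulus b / a to m.\<close>
    have "((\<lambda>x. 1 / sqrt (1 - (b / a)\<^sup>2 * x\<^sup>2) / sqrt (1\<^sup>2 - x\<^sup>2)) has_integral
           integral {0..pi/2} (\<lambda>t. 1 / sqrt (1 - (b / a)\<^sup>2 * (1 * sin t)\<^sup>2))) {0..1}"
      by (rule has_integral_sin_substitution)
         (auto simp: root1 intro!: set_integrable_mult_right P simp del: times_divide_eq_right)
    also have "integral {0..pi/2} (\<lambda>t. 1 / sqrt (1 - (b / a)\<^sup>2 * (1 * sin t)\<^sup>2)) = a / sqrt d * P"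
      unfolding P_def mult_1 root1 by (rule integral_mult_right)
    finally show ?thesis
      unfolding ellK_def by (intro integral_unique) (simp add: real_sqrt_mult mult.commute)
  qed
  then have K: "1 / a * ellK (b / a) = P / sqrt d" using \<open>a > 0\<close> by simp

  \<comment> \<open>The splitting ln (b sin t) = ln b + ln (sin t), valid for t > 0; the point 0 is
    discarded as a null set.\<close>
  let ?g = "\<lambda>t. ln b / sqrt d * (1 / sqrt (1 + m * (cos t)\<^sup>2)) + 1 / sqrt d * (ln (sin t) / sqrt (1 + m * (cos t)\<^sup>2))"
  have g: "?g absolutely_integrable_on {0..pi/2}"
    by (intro set_integral_add set_integrable_mult_right P Q)
  have g_eq: "?g t = ln (b * sin t) / sqrt (a\<^sup>2 - (b * sin t)\<^sup>2)" if "t \<in> {0..pi/2} - {0}" for t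
  proof -
    have "sin t > 0" using that by (intro sin_gt_zero) auto
    then show ?thesis using assms(1) d by (simp add: root ln_mult add_divide_distrib)
  qed
  have "(\<lambda>t. ln (b * sin t) / sqrt (a\<^sup>2 - (b * sin t)\<^sup>2)) absolutely_integrable_on {0..pi/2}"
    by (rule absolutely_integrable_spike[OF g, of "{0}"]) (use g_eq in auto)
  from has_integral_sin_substitution[OF assms(1) this]
  have "((\<lambda>x. ln x / sqrt ((a\<^sup>2 - x\<^sup>2) * (b\<^sup>2 - x\<^sup>2))) has_integral
       integral {0..pi/2} (\<lambda>t. ln (b * sin t) / sqrt (a\<^sup>2 - (b * sin t)\<^sup>2))) {0..b}"
    by (simp add: real_sqrt_mult)
  also have "integral {0..pi/2} (\<lambda>t. ln (b * sin t) / sqrt (a\<^sup>2 - (b * sin t)\<^sup>2)) = integral {0..pi/2} ?g"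
    by (rule integral_spike[of "{0}"]) (use g_eq in auto)
  also have "integral {0..pi/2} ?g = ln b / sqrt d * P + 1 / sqrt d * Q"
    unfolding P_def Q_def
    by (intro integral_unique has_integral_add has_integral_mult_right integrable_integral)
       (use P(1) Q(1) in \<open>auto simp: absolutely_integrable_on_def\<close>)
  \<comment> \<open>The term - ln 2 * P inside \<open>Q\<close> joins ln b * P to produce ln (b /
    2).\<close>
  also have "\<dots> = ln (b / 2) * (P / sqrt d) - pi / (4 * sqrt d) * harmF (m / 16)"
    using assms(1) by (simp add: Q_eq ln_div diff_divide_distrib algebra_simps)
  also have "\<dots> = 1 / a * ln (b / 2) * ellK (b / a) - pi / (4 * sqrt d) * harmF (m / 16)"
    unfolding K[symmetric] by simp
  also have "m / 16 = b\<^sup>2 / (16 * d)"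
    by (simp add: m_def)
  finally show ?thesis
    unfolding d_def .
qed

end
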